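(* Let $\sigma$ be a labeled rooted forest on the vertex set $[n]$. Let $\chi^{\mathbf 1}$ denote the character of the unique irreducible (one-dimensional) representation of $S_1$. Let $\widetilde{\sigma}$ be the labeled rooted tree on $[n+1]$ obtained from $\sigma$ by connecting its roots to a new root labeled $n+1$. Then $$\chi^{o(\widetilde{\sigma})}=\chi^{\mathbf 1}\cdot\chi^{o(\sigma)}.$$
   Context: $[n]=\{1,\dots,n\}$. The symmetric group $S_n$ acts on labeled rooted forests with vertex set $[n]$ by permuting labels (this is the conjugation action on the corresponding nilpotent partial transformations $f$ of $[n]$, where $f(i)$ is the parent of $i$ and $f$ is undefined on roots). For a labeled rooted forest $\sigma$ on $[n]$, $o(\sigma)$ (the odun of $\sigma$) is the permutation representation of $S_n$ on the orbit $S_n\cdot\sigma$, and $\chi^{o(\sigma)}$ is its character. The product of a character $\chi$ of $S_m$ and a character $\psi$ of $S_n$ is the induction product $\chi\cdot\psi=\mathrm{Ind}_{S_m\times S_n}^{S_{m+n}}(\chi\otimes\psi)$. *)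

theory Defs
  imports
    Complex_Main
    "HOL-Library.FuncSet"
    "HOL-Combinatorics.Permutations"
    "HOL-Algebra.Group_Action"
    "HOL-Algebra.Sym_Groups"
begin

section \<open>Complex matrix representations of groups\<close>

text \<open>A matrix representation is a finite index set \<open>B\<close> together with a family of matrices
  with rows and columns indexed by \<open>B\<close>; it stands for the action on the vector space with basis
  \<open>B\<close>. Only the entries \<open>\<rho> g x y\<close> with \<open>x, y \<in> B\<close> matter.\<close>

type_synonym ('g, 'b) matrix_rep = "'b set \<times> ('g \<Rightarrow> 'b \<Rightarrow> 'b \<Rightarrow> complex)"

definition is_rep :: "('g, 'm) monoid_scheme \<Rightarrow> ('g, 'b) matrix_rep \<Rightarrow> bool" where
  "is_rep G R \<longleftrightarrow> (case R of (B, \<rho>) \<Rightarrow>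
     finite B \<and>
     (\<forall>x\<in>B. \<forall>y\<in>B. \<rho> \<one>\<^bsub>G\<^esub> x y = (if x = y then 1 else 0)) \<and>
     (\<forall>g\<in>carrier G. \<forall>h\<in>carrier G. \<forall>x\<in>B. \<forall>y\<in>B.
        \<rho> (g \<otimes>\<^bsub>G\<^esub> h) x y = (\<Sum>z\<in>B. \<rho> g x z * \<rho> h z y)))"

definition rep_char :: "('g, 'b) matrix_rep \<Rightarrow> 'g \<Rightarrow> complex" where
  "rep_char R g = (case R of (B, \<rho>) \<Rightarrow> \<Sum>x\<in>B. \<rho> g x x)"

text \<open>The column vectors indexed by \<open>B\<close>, as functions vanishing outside \<open>B\<close>.\<close>

definition vectors :: "'b set \<Rightarrow> ('b \<Rightarrow> complex) set" where
  "vectors B = {v. \<forall>x. x \<notin> B \<longrightarrow> v x = 0}"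

definition mat_app :: "'b set \<Rightarrow> ('b \<Rightarrow> 'b \<Rightarrow> complex) \<Rightarrow> ('b \<Rightarrow> complex) \<Rightarrow> ('b \<Rightarrow> complex)" where
  "mat_app B M v = (\<lambda>x. if x \<in> B then (\<Sum>y\<in>B. M x y * v y) else 0)"

definition linear_subspace :: "('b \<Rightarrow> complex) set \<Rightarrow> 'b set \<Rightarrow> bool" where
  "linear_subspace W B \<longleftrightarrow>
     W \<subseteq> vectors B \<and> (\<lambda>_. 0) \<in> W \<and>
     (\<forall>v\<in>W. \<forall>w\<in>W. (\<lambda>x. v x + w x) \<in> W) \<and>
     (\<forall>c. \<forall>v\<in>W. (\<lambda>x. c * v x) \<in> W)"

definition irreducible_rep :: "('g, 'm) monoid_scheme \<Rightarrow> ('g, 'b) matrix_rep \<Rightarrow> bool" where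
  "irreducible_rep G R \<longleftrightarrow> is_rep G R \<and> (case R of (B, \<rho>) \<Rightarrow>
     B \<noteq> {} \<and>
     (\<forall>W. linear_subspace W B \<and> (\<forall>g\<in>carrier G. \<forall>v\<in>W. mat_app B (\<rho> g) v \<in> W)
        \<longrightarrow> W = {\<lambda>_. 0} \<or> W = vectors B))"

lemma irreducible_rep_S1:
  "irreducible_rep (sym_group 1) ({()}, \<lambda>g x y. 1)"
  unfolding irreducible_rep_def
proof (intro conjI; clarsimp)
  show "is_rep (sym_group (Suc 0)) ({()}, \<lambda>g x y. 1)" by (simp add: is_rep_def)
  fix W assume W: "linear_subspace W {()}" and ne: "W \<noteq> vectors {()}"
  have sc: "(\<lambda>x. c * v x) \<in> W" if "v \<in> W" for c v
    using W that by (auto simp: linear_subspace_def)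
  have z: "(\<lambda>_. 0) \<in> W" "W \<subseteq> vectors {()}" using W by (auto simp: linear_subspace_def)
  show "W = {\<lambda>_. 0}"
  proof (rule ccontr)
    assume "W \<noteq> {\<lambda>_. 0}"
    then obtain v where v: "v \<in> W" "v \<noteq> (\<lambda>_. 0)" using z by blast
    then have "v () \<noteq> 0" by (auto simp: fun_eq_iff)
    then have "w \<in> W" for w
      using sc[OF v(1), of "w () / v ()"] by (simp add: fun_eq_iff)
    then have "W = vectors {()}" using z by blast
    then show False using ne by simp
  qed
qed

text \<open>The permutation representation on a set \<open>X\<close> under an action \<open>\<phi>\<close>: the basis vector
  indexed by \<open>y\<close> is sent by \<open>g\<close> to the one indexed by \<open>\<phi> g y\<close>.\<close>

definition permutation_rep :: "'b set \<Rightarrow> ('g \<Rightarrow> 'b \<Rightarrow> 'b) \<Rightarrow> ('g, 'b) matrix_rep" where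
  "permutation_rep X \<phi> = (X, \<lambda>g x y. if x = \<phi> g y then 1 else 0)"


section \<open>The induction product\<close>

text \<open>Induction of a class function \<open>\<chi>\<close> of \<open>H\<close> to \<open>G\<close>, where \<open>H\<close> is regarded as a subgroup of
  \<open>G\<close> by means of an injective homomorphism \<open>\<iota>\<close>: the sum is over all \<open>x \<in> G\<close> for which
  \<open>x\<^sup>-\<^sup>1 g x\<close> lies in the subgroup \<open>\<iota> H\<close>, the inner sum then having exactly one term.\<close>

definition ind_char ::
  "('g, 'm) monoid_scheme \<Rightarrow> ('h, 'k) monoid_scheme \<Rightarrow> ('h \<Rightarrow> 'g) \<Rightarrow> ('h \<Rightarrow> complex) \<Rightarrow> 'g \<Rightarrow> complex"
where
  "ind_char G H \<iota> \<chi> g =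
     (\<Sum>x\<in>carrier G. \<Sum>h | h \<in> carrier H \<and> \<iota> h = inv\<^bsub>G\<^esub> x \<otimes>\<^bsub>G\<^esub> g \<otimes>\<^bsub>G\<^esub> x. \<chi> h)
       / of_nat (order H)"

definition tensor_char :: "('g \<Rightarrow> complex) \<Rightarrow> ('h \<Rightarrow> complex) \<Rightarrow> 'g \<times> 'h \<Rightarrow> complex" where
  "tensor_char \<chi> \<psi> = (\<lambda>(g, h). \<chi> g * \<psi> h)"

text \<open>The standard embedding of \<open>S\<^sub>m \<times> S\<^sub>n\<close> into \<open>S\<^bsub>m+n\<^esub>\<close>: the first factor permutes
  \<open>1, \<dots>, m\<close> and the second one \<open>m + 1, \<dots>, m + n\<close>.\<close>

definition young_embed :: "nat \<Rightarrow> (nat \<Rightarrow> nat) \<times> (nat \<Rightarrow> nat) \<Rightarrow> (nat \<Rightarrow> nat)" where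
  "young_embed m = (\<lambda>(p, q) i. if i \<le> m then p i else m + q (i - m))"

definition ind_prod ::
  "nat \<Rightarrow> nat \<Rightarrow> ((nat \<Rightarrow> nat) \<Rightarrow> complex) \<Rightarrow> ((nat \<Rightarrow> nat) \<Rightarrow> complex) \<Rightarrow> (nat \<Rightarrow> nat) \<Rightarrow> complex"
where
  "ind_prod m n \<chi> \<psi> =
     ind_char (sym_group (m + n)) (sym_group m \<times>\<times> sym_group n) (young_embed m) (tensor_char \<chi> \<psi>)"

lemma young_embed_hom:
  "young_embed m \<in> hom (sym_group m \<times>\<times> sym_group n) (sym_group (m + n))"
proof (rule homI)
  fix x assume "x \<in> carrier (sym_group m \<times>\<times> sym_group n)"
  then obtain p q where x: "x = (p, q)" and p: "p permutes {1..m}" and q: "q permutes {1..n}"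
    by (auto simp: sym_group_carrier)
  have p0: "p i \<le> m \<longleftrightarrow> i \<le> m" for i
    using permutes_in_image[OF p, of i] permutes_not_in[OF p, of i] by force
  have q0: "q 0 = 0" using permutes_not_in[OF q, of 0] by simp
  have qpos: "q k \<noteq> 0" if "k \<noteq> 0" for k
    using permutes_inj[OF q] q0 that by (metis injD)
  show "young_embed m x \<in> carrier (sym_group (m + n))"
    unfolding sym_group_carrier
  proof (rule bij_imp_permutes)
    have inj: "inj_on (young_embed m x) {1..m+n}"
    proof (rule inj_onI)
      fix i j assume e: "young_embed m x i = young_embed m x j"
      have *: "p a \<noteq> m + q (b - m)" if "a \<le> m" "\<not> b \<le> m" for a b
        using p0[of a] qpos[of "b - m"] that by auto
      show "i = j"
      proof (cases "i \<le> m"; cases "j \<le> m")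
        assume "i \<le> m" "j \<le> m"
        then show ?thesis using e permutes_inj[OF p] by (auto simp: x young_embed_def dest: injD)
      next
        assume a: "\<not> i \<le> m" "\<not> j \<le> m"
        then have "i - m = j - m"
          using e permutes_inj[OF q] by (auto simp: x young_embed_def dest: injD)
        then show ?thesis using a by linarith
      qed (use e *[of i j] *[of j i] in \<open>auto simp: x young_embed_def\<close>)
    qed
    have "young_embed m x i \<in> {1..m+n}" if "i \<in> {1..m+n}" for i
    proof (cases "i \<le> m")
      case True
      then have "p i \<in> {1..m}" using permutes_in_image[OF p, of i] that by auto
      then show ?thesis using True by (auto simp: x young_embed_def)
    next
      case False
      then have "q (i - m) \<in> {1..n}" using permutes_in_image[OF q, of "i - m"] that by auto
      then show ?thesis using False by (auto simp: x young_embed_def)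
    qed
    then have "young_embed m x ` {1..m+n} \<subseteq> {1..m+n}" by blast
    then show "bij_betw (young_embed m x) {1..m+n} {1..m+n}"
      using inj by (simp add: bij_betw_def endo_inj_surj)
  next
    fix i assume i: "i \<notin> {1..m+n}"
    show "young_embed m x i = i"
    proof (cases "i \<le> m")
      case True
      then have "i \<notin> {1..m}" using i by auto
      then show ?thesis using True permutes_not_in[OF p] by (auto simp: x young_embed_def)
    next
      case False
      then have "i - m \<notin> {1..n}" using i by auto
      then show ?thesis using False permutes_not_in[OF q] by (auto simp: x young_embed_def)
    qed
  qed
next
  fix x y assume "x \<in> carrier (sym_group m \<times>\<times> sym_group n)"
    and "y \<in> carrier (sym_group m \<times>\<times> sym_group n)"
  then obtain p q p' q' where xy: "x = (p, q)" "y = (p', q')"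
    and p': "p' permutes {1..m}" and q': "q' permutes {1..n}"
    by (auto simp: sym_group_carrier)
  have p0: "p' i \<le> m \<longleftrightarrow> i \<le> m" for i
    using permutes_in_image[OF p', of i] permutes_not_in[OF p', of i] by force
  have "q' 0 = 0" using permutes_not_in[OF q', of 0] by simp
  then have "q' k = 0 \<longleftrightarrow> k = 0" for k
    using permutes_inj[OF q'] by (metis injD)
  then show "young_embed m (x \<otimes>\<^bsub>sym_group m \<times>\<times> sym_group n\<^esub> y) =
      young_embed m x \<otimes>\<^bsub>sym_group (m + n)\<^esub> young_embed m y"
    by (auto simp: xy sym_group_mult young_embed_def fun_eq_iff p0)
qed

lemma young_embed_inj:
  "inj_on (young_embed m) (carrier (sym_group m \<times>\<times> sym_group n))"
proof (rule inj_onI, clarsimp simp: sym_group_carrier)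
  fix p q p' q'
  assume pq: "p permutes {Suc 0..m}" "q permutes {Suc 0..n}" "p' permutes {Suc 0..m}"
      "q' permutes {Suc 0..n}"
    and e: "young_embed m (p, q) = young_embed m (p', q')"
  have "p i = p' i" for i
  proof (cases "i \<le> m")
    case True
    then show ?thesis using fun_cong[OF e, of i] by (simp add: young_embed_def)
  next
    case False
    then show ?thesis
      using permutes_not_in[OF pq(1), of i] permutes_not_in[OF pq(3), of i] by simp
  qed
  moreover have "q i = q' i" for i
  proof (cases "i = 0")
    case True
    then show ?thesis
      using permutes_not_in[OF pq(2), of i] permutes_not_in[OF pq(4), of i] by simp
  next
    case False
    then show ?thesis using fun_cong[OF e, of "m + i"] by (simp add: young_embed_def)
  qed
  ultimately show "p = p' \<and> q = q'" by blast
qed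


section \<open>Labeled rooted forests and their oduns\<close>

text \<open>A labeled rooted forest on \<open>{1..n}\<close> is given by its parent function, a nilpotent partial
  transformation of \<open>{1..n}\<close>; the roots are the vertices where it is undefined.\<close>

definition nilpotent_map :: "('a \<Rightarrow> 'a option) \<Rightarrow> bool" where
  "nilpotent_map f \<longleftrightarrow> (\<exists>k. ((\<circ>\<^sub>m) f ^^ k) Some = Map.empty)"

definition rooted_forest :: "nat \<Rightarrow> (nat \<Rightarrow> nat option) \<Rightarrow> bool" where
  "rooted_forest n f \<longleftrightarrow> dom f \<subseteq> {1..n} \<and> ran f \<subseteq> {1..n} \<and> nilpotent_map f"

definition roots :: "nat \<Rightarrow> (nat \<Rightarrow> nat option) \<Rightarrow> nat set" where
  "roots n f = {i \<in> {1..n}. f i = None}"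

text \<open>The conjugate of \<open>f\<close> by the permutation \<open>p\<close>.\<close>

definition relabel :: "(nat \<Rightarrow> nat) \<Rightarrow> (nat \<Rightarrow> nat option) \<Rightarrow> (nat \<Rightarrow> nat option)" where
  "relabel p f = map_option p \<circ> f \<circ> Hilbert_Choice.inv p"

definition odun :: "nat \<Rightarrow> (nat \<Rightarrow> nat option) \<Rightarrow> (nat \<Rightarrow> nat, nat \<Rightarrow> nat option) matrix_rep" where
  "odun n f = permutation_rep (orbit (sym_group n) relabel f) relabel"

definition add_root :: "nat \<Rightarrow> (nat \<Rightarrow> nat option) \<Rightarrow> (nat \<Rightarrow> nat option)" where
  "add_root n f = (\<lambda>i. if i \<in> roots n f then Some (n + 1) else f i)"

lemma odun_is_rep: "is_rep (sym_group n) (odun n f)"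
proof -
  let ?X = "orbit (sym_group n) relabel f"
  have comp: "relabel (g \<circ> h) x = relabel g (relabel h x)"
    if "g permutes {1..n}" "h permutes {1..n}" for g h x
    using that by (simp add: relabel_def o_inv_distrib permutes_bij comp_assoc
        fun_eq_iff option.map_comp)
  have X: "?X = (\<lambda>g. relabel g f) ` {p. p permutes {1..n}}"
    by (auto simp: orbit_def sym_group_carrier)
  have fin: "finite ?X" unfolding X by (simp add: finite_permutations)
  have cl: "relabel h y \<in> ?X" if "h permutes {1..n}" "y \<in> ?X" for h y
    using that by (auto simp: X comp[symmetric] intro!: imageI permutes_compose)
  have one: "relabel id x = x" for x
    by (simp add: relabel_def fun_eq_iff option.map_id)
  have sum: "(\<Sum>z\<in>?X. (if x = relabel g z then 1 else 0) * (if z = relabel h y then 1 else 0))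
      = (if x = relabel g (relabel h y) then 1 else (0::complex))"
    if "h permutes {1..n}" "y \<in> ?X" for g h x y
  proof -
    have "(\<Sum>z\<in>?X. (if x = relabel g z then 1 else 0) * (if z = relabel h y then 1 else (0::complex)))
      = (\<Sum>z\<in>?X. if z = relabel h y then (if x = relabel g z then 1 else 0) else 0)"
      by (intro sum.cong) auto
    then show ?thesis using cl[OF that] fin by simp
  qed
  show ?thesis
    using fin sum by (auto simp: is_rep_def odun_def permutation_rep_def sym_group_one sym_group_mult
        sym_group_carrier one comp)
qed

lemma add_root_forest:
  assumes f: "rooted_forest n f"
  shows "rooted_forest (n + 1) (add_root n f)" "roots (n + 1) (add_root n f) = {n + 1}"
proof -
  let ?g = "add_root n f"
  have d: "dom f \<subseteq> {1..n}" and r: "ran f \<subseteq> {1..n}" using f by (auto simp: rooted_forest_def)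
  obtain k where k: "(((\<circ>\<^sub>m) f ^^ k) Some) = Map.empty"
    using f by (auto simp: rooted_forest_def nilpotent_map_def)
  have out: "f i = None" if "i \<notin> {1..n}" for i using d that by auto
  have g: "?g i = (if i \<in> {1..n} then (case f i of None \<Rightarrow> Some (n+1) | Some j \<Rightarrow> Some j) else None)" for i
    using out by (auto simp: add_root_def roots_def split: option.splits)
  show "roots (n + 1) ?g = {n + 1}"
    by (auto simp: roots_def g split: option.splits)
  have iter: "((\<circ>\<^sub>m) ?g ^^ j) Some i = ((\<circ>\<^sub>m) f ^^ j) Some i \<or>
     ((\<circ>\<^sub>m) f ^^ j) Some i = None \<and> ((\<circ>\<^sub>m) ?g ^^ j) Some i \<in> {None, Some (n+1)}" for i j
    by (induction j) (auto simp: map_comp_def g out split: option.splits)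
  have "((\<circ>\<^sub>m) ?g ^^ k) Some i \<in> {None, Some (n+1)}" for i
    using iter[of k i] k by auto
  moreover have "?g (n + 1) = None" by (simp add: g)
  ultimately have "((\<circ>\<^sub>m) ?g ^^ Suc k) Some i = None" for i
    by (simp add: map_comp_def split: option.splits)
      (metis insertE option.distinct(1) option.inject singletonD)
  then have "nilpotent_map ?g" unfolding nilpotent_map_def by blast
  moreover have "dom ?g \<subseteq> {1..n+1}" by (auto simp: g split: if_splits)
  moreover have "ran ?g \<subseteq> {1..n+1}" using r by (fastforce simp: ran_def g split: if_splits option.splits)
  ultimately show "rooted_forest (n + 1) ?g" by (simp add: rooted_forest_def)
qed

end

theory Submission
  imports Defs
begin

text \<open>Both sides count fixed points. Up to conjugation by a cycle, the Young embedding of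
  \<open>S\<^sub>1 \<times> S\<^sub>n\<close> is the inclusion of the stabilizer \<open>S\<^sub>n\<close> of \<open>n + 1\<close>. Adding a root is
  \<open>S\<^sub>n\<close>-equivariant and injective, and a permutation carrying one tree with root \<open>n + 1\<close> to another
  one lies in \<open>S\<^sub>n\<close>. Hence the map sending \<open>(y, \<tau>)\<close>, with \<open>y\<close> in \<open>S\<^bsub>n+1\<^esub>\<close> and \<open>\<tau>\<close> in the
  orbit of \<open>\<sigma>\<close>, to the relabelling by \<open>y\<close> of \<open>\<tau>\<close> with a new root is onto the orbit of the new tree,
  has all fibres of size \<open>n!\<close>, and turns the induced character into \<open>n!\<close> times the number of fixed
  points, divided by \<open>n!\<close>.\<close>

section \<open>Characters of the trivial group and of permutation representations\<close>

text \<open>The identity acts by the identity matrix, so every subspace is invariant and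
  irreducibility forces dimension one. The trace is then a single entry 1.\<close>

lemma irreducible_rep_trivial_group_char:
  fixes R :: "('g, 'b) matrix_rep"
  assumes G: "carrier G = {\<one>\<^bsub>G\<^esub>}" and irr: "irreducible_rep G R"
  shows "rep_char R \<one>\<^bsub>G\<^esub> = 1"
proof -
  obtain B \<rho> where R: "R = (B, \<rho>)" by (cases R)
  have \<rho>1: "\<rho> \<one>\<^bsub>G\<^esub> x y = (if x = y then 1 else 0)"
    if "x \<in> B" "y \<in> B" for x y
    using irr that by (auto simp: R irreducible_rep_def is_rep_def)
  have fin: "finite B" using irr by (auto simp: R irreducible_rep_def is_rep_def)
  have sub: "W = {\<lambda>_. 0} \<or> W = vectors B"
    if "linear_subspace W B" "\<And>v. v \<in> W \<Longrightarrow> mat_app B (\<rho> \<one>\<^bsub>G\<^esub>) v \<in> W" for W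
    using irr that by (auto simp: R irreducible_rep_def G)
  obtain b where b: "b \<in> B" using irr by (auto simp: R irreducible_rep_def)
  \<comment> \<open>The line spanned by the basis vector at \<open>b\<close>.\<close>
  define W where "W = {v :: 'b \<Rightarrow> complex. \<forall>x. x \<noteq> b \<longrightarrow> v x = 0}"
  have app: "mat_app B (\<rho> \<one>\<^bsub>G\<^esub>) v = v" if "v \<in> vectors B" for v
  proof
    fix x
    have "(\<Sum>y\<in>B. \<rho> \<one>\<^bsub>G\<^esub> x y * v y) = (\<Sum>y\<in>B. if x = y then v y else 0)" if "x \<in> B"
      using that by (intro sum.cong) (auto simp: \<rho>1)
    then show "mat_app B (\<rho> \<one>\<^bsub>G\<^esub>) v x = v x"
      using fin that by (auto simp: mat_app_def vectors_def)
  qed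
  have WB: "W \<subseteq> vectors B" using b by (auto simp: W_def vectors_def)
  have "linear_subspace W B" using WB by (auto simp: linear_subspace_def W_def)
  then have "W = {\<lambda>_. 0} \<or> W = vectors B"
    by (rule sub) (use WB in \<open>simp add: app subset_iff\<close>)
  moreover have "(\<lambda>x. if x = b then 1 else 0) \<in> W" by (simp add: W_def)
  then have "W \<noteq> {\<lambda>_. 0}" by (auto dest: fun_cong[of _ _ b])
  ultimately have W: "W = vectors B" by simp
  \<comment> \<open>A second index would give a basis vector outside the line \<open>W\<close>,
    which is already the whole space.\<close>
  have "x = b" if "x \<in> B" for x
  proof (rule ccontr)
    assume "x \<noteq> b"
    moreover have "(\<lambda>y. if y = x then 1 else 0) \<in> W" using that by (simp add: W vectors_def)
    ultimately show False by (auto simp: W_def)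
  qed
  then have "B = {b}" using b by blast
  then show ?thesis using \<rho>1 by (simp add: rep_char_def R)
qed

lemma rep_char_permutation_rep:
  assumes "finite X"
  shows "rep_char (permutation_rep X \<phi>) g = of_nat (card {x \<in> X. \<phi> g x = x})"
proof -
  have "rep_char (permutation_rep X \<phi>) g = (\<Sum>x\<in>X. if \<phi> g x = x then 1 else 0)"
    by (auto simp: rep_char_def permutation_rep_def intro!: sum.cong)
  then show ?thesis using assms by (simp add: sum.If_cases Int_def)
qed

section \<open>Relabelling as an action of the symmetric group\<close>

lemma relabel_comp:
  assumes "bij g" "bij h"
  shows "relabel (g \<circ> h) f = relabel g (relabel h f)"
  using assms by (simp add: relabel_def o_inv_distrib comp_assoc fun_eq_iff option.map_comp)

lemma relabel_id: "relabel id f = f"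
  by (simp add: relabel_def fun_eq_iff option.map_id)

lemma relabel_apply: "bij p \<Longrightarrow> relabel p f (p i) = map_option p (f i)"
  by (simp add: relabel_def bij_is_inj)

lemma relabel_inv_cancel:
  assumes "bij p"
  shows "relabel (inv' p) (relabel p f) = f" "relabel p (relabel (inv' p) f) = f"
  using assms by (simp_all flip: relabel_comp add: bij_imp_bij_inv bij_is_inj bij_is_surj
      surj_iff[THEN iffD1] relabel_id)

lemma relabel_eq_iff:
  assumes "bij p"
  shows "relabel p f = relabel p f' \<longleftrightarrow> f = f'"
  using relabel_inv_cancel(1)[OF assms] by metis

lemma sym_group_inv:
  assumes "p permutes {1..n}"
  shows "inv\<^bsub>sym_group n\<^esub> p = inv' p"
  using assms sym_group_inv_equality by (simp add: sym_group_carrier)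

lemma sym_group_orbit:
  "orbit (sym_group n) relabel f = (\<lambda>p. relabel p f) ` {p. p permutes {1..n}}"
  by (auto simp: orbit_def sym_group_carrier)

lemma rep_char_odun:
  "rep_char (odun n f) g = of_nat (card {x \<in> orbit (sym_group n) relabel f. relabel g x = x})"
  unfolding odun_def
  by (rule rep_char_permutation_rep) (simp add: sym_group_orbit finite_permutations)

section \<open>Adding a root and its equivariance\<close>

text \<open>The domain and range condition of \<open>rooted_forest\<close>; being stable under
  relabelling, it passes from \<sigma> to its whole orbit.\<close>

definition partial_map_on :: "'a set \<Rightarrow> ('a \<Rightarrow> 'a option) \<Rightarrow> bool" where
  "partial_map_on A f \<longleftrightarrow> dom f \<subseteq> A \<and> ran f \<subseteq> A"

lemma partial_map_on_relabel:
  assumes p: "p permutes A" and f: "partial_map_on A f"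
  shows "partial_map_on A (relabel p f)"
proof -
  have "x \<in> A \<and> y \<in> A" if xy: "relabel p f x = Some y" for x y
  proof -
    obtain z where z: "f (inv' p x) = Some z" "y = p z"
      using xy by (auto simp: relabel_def)
    then have "inv' p x \<in> A" "z \<in> A"
      using f by (auto simp: partial_map_on_def ran_def)
    then show ?thesis
      using z(2) permutes_in_image[OF p] permutes_in_image[OF permutes_inv[OF p]] by metis
  qed
  then show ?thesis by (auto simp: partial_map_on_def ran_def)
qed

text \<open>Makes the new root recognizable: \<open>n + 1\<close> is the only vertex of
  \<open>{1..n+1}\<close> without a parent.\<close>

lemma add_root_eq_None_iff:
  assumes "partial_map_on {1..n} f"
  shows "add_root n f i = None \<longleftrightarrow> i \<notin> {1..n}"
  using assms by (auto simp: add_root_def roots_def partial_map_on_def)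

text \<open>The map can be recovered by erasing the value \<open>n + 1\<close>, which it never takes
  itself.\<close>

lemma add_root_eq_iff:
  assumes f: "partial_map_on {1..n} f" and f': "partial_map_on {1..n} f'"
  shows "add_root n f = add_root n f' \<longleftrightarrow> f = f'"
proof -
  have *: "h = (\<lambda>i. if add_root n h i = Some (n + 1) then None else add_root n h i)"
    if "partial_map_on {1..n} h" for h
  proof
    fix i
    have "h i \<noteq> Some (n + 1)"
      using that by (fastforce simp: partial_map_on_def ran_def)
    then show "h i = (if add_root n h i = Some (n + 1) then None else add_root n h i)"
      using that by (auto simp: add_root_def roots_def)
  qed
  show ?thesis using *[OF f] *[OF f'] by metis
qed

text \<open>A permutation of \<open>{1..n}\<close> carries old roots to old roots and fixes the new
  root \<open>n + 1\<close>.\<close>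

lemma relabel_add_root:
  assumes q: "q permutes {1..n}"
  shows "relabel q (add_root n f) = add_root n (relabel q f)"
proof
  fix i
  obtain j where i: "i = q j" using permutes_surj[OF q] by (metis surjD)
  have "q (n + 1) = n + 1" using permutes_not_in[OF q] by simp
  then show "relabel q (add_root n f) i = add_root n (relabel q f) i"
    unfolding i using q permutes_in_image[OF q, of j]
    by (auto simp: add_root_def roots_def relabel_apply permutes_bij)
qed

text \<open>Relabelling carries roots to roots, and both trees have \<open>n + 1\<close> as their
  only root, so \<open>y\<close> fixes it.\<close>

lemma permutes_if_relabel_add_root:
  assumes y: "y permutes {1..n+1}"
    and f: "partial_map_on {1..n} f" and f': "partial_map_on {1..n} f'"
    and eq: "relabel y (add_root n f) = add_root n f'"
  shows "y permutes {1..n}"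
proof -
  have "add_root n f (n + 1) = None" using add_root_eq_None_iff[OF f] by simp
  then have "add_root n f' (y (n + 1)) = None"
    using relabel_apply[OF permutes_bij[OF y]] eq by (metis option.map_disc_iff)
  then have "y (n + 1) \<notin> {1..n}" using add_root_eq_None_iff[OF f'] by simp
  moreover have "y (n + 1) \<in> {1..n+1}" using permutes_in_image[OF y] by simp
  ultimately have "y (n + 1) = n + 1" by auto
  moreover have "{1..n+1} - {1..n} = {n + 1}" by auto
  ultimately show ?thesis by (intro permutes_superset[OF y]) simp
qed

section \<open>Counting fibres and fixed points\<close>

text \<open>The fibre over a tree in the orbit is parametrized by S_n: a factor \<open>q\<close> can
  be moved between the outer permutation and the forest, because adding a root commutes with
  \<open>q\<close>.\<close>

lemma card_orbit_pairs:
  fixes n :: nat and \<sigma> :: "nat \<Rightarrow> nat option"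
  defines "X \<equiv> orbit (sym_group n) relabel \<sigma>"
  assumes \<sigma>: "partial_map_on {1..n} \<sigma>" and z: "z permutes {1..n+1}"
  shows "card {(y, \<tau>). y permutes {1..n+1} \<and> \<tau> \<in> X \<and>
           relabel y (add_root n \<tau>) = relabel z (add_root n \<sigma>)} = fact n"
proof -
  have up: "q permutes {1..n+1}" if "q permutes {1..n}" for q
    by (rule permutes_subset[OF that]) auto
  have X: "X = (\<lambda>p. relabel p \<sigma>) ` {p. p permutes {1..n}}"
    by (simp add: X_def sym_group_orbit)
  define F where "F = {(y, \<tau>). y permutes {1..n+1} \<and> \<tau> \<in> X \<and>
           relabel y (add_root n \<tau>) = relabel z (add_root n \<sigma>)}"
  define k where "k = (\<lambda>q. (z \<circ> q, relabel (inv' q) \<sigma>))"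
  have inj: "inj_on k {q. q permutes {1..n}}"
  proof (rule inj_onI)
    fix q q' assume "k q = k q'"
    then have "z \<circ> q = z \<circ> q'" by (simp add: k_def)
    then show "q = q'" using permutes_inj[OF z] by (auto simp: fun_eq_iff dest: injD)
  qed
  have "k ` {q. q permutes {1..n}} = F"
  proof (intro equalityI subsetI)
    fix w assume "w \<in> k ` {q. q permutes {1..n}}"
    then obtain q where q: "q permutes {1..n}" and w: "w = k q" by blast
    have "relabel (z \<circ> q) (add_root n (relabel (inv' q) \<sigma>)) = relabel z (add_root n \<sigma>)"
      using z q by (simp add: relabel_comp permutes_bij relabel_add_root relabel_inv_cancel)
    then show "w \<in> F"
      using permutes_compose[OF up[OF q] z] permutes_inv[OF q]
      by (auto simp: w k_def F_def X)
  next
    fix w assume "w \<in> F"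
    then obtain y \<tau> where w: "w = (y, \<tau>)" and y: "y permutes {1..n+1}" and \<tau>X: "\<tau> \<in> X"
      and eq: "relabel y (add_root n \<tau>) = relabel z (add_root n \<sigma>)"
      by (auto simp: F_def)
    have \<tau>: "partial_map_on {1..n} \<tau>" using \<tau>X \<sigma> by (auto simp: X partial_map_on_relabel)
    \<comment> \<open>The only candidate for the parameter; it carries one tree rooted at
      \<open>n + 1\<close> to another and hence lies in S_n.\<close>
    let ?q = "inv' z \<circ> y"
    have q1: "?q permutes {1..n+1}" using y z by (simp add: permutes_compose permutes_inv)
    have e: "relabel ?q (add_root n \<tau>) = add_root n \<sigma>"
      using y z by (simp add: relabel_comp permutes_bij permutes_inv eq relabel_inv_cancel
          bij_imp_bij_inv)
    have q: "?q permutes {1..n}" by (rule permutes_if_relabel_add_root[OF q1 \<tau> \<sigma> e])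
    have "relabel ?q \<tau> = \<sigma>"
      using e add_root_eq_iff[OF partial_map_on_relabel[OF q \<tau>] \<sigma>] by (simp add: relabel_add_root[OF q])
    then have "\<tau> = relabel (inv' ?q) \<sigma>" using relabel_inv_cancel(1)[OF permutes_bij[OF q]] by metis
    moreover have "y = z \<circ> ?q" using permutes_inv_o[OF z] by (simp flip: comp_assoc)
    ultimately have "w = k ?q" by (simp add: w k_def)
    then show "w \<in> k ` {q. q permutes {1..n}}" using q by blast
  qed
  then have "card F = card {q. q permutes {1..n}}" using card_image[OF inj] by simp
  also have "\<dots> = fact n" by (rule card_permutations) auto
  finally show ?thesis by (simp add: F_def)
qed

text \<open>Double counting of the pairs whose tree is fixed by \<open>g\<close>: grouped by the
  tree they yield, each fixed tree is counted \<open>fact n\<close> times.\<close>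

lemma fixed_points_add_root:
  fixes n :: nat and \<sigma> :: "nat \<Rightarrow> nat option"
  defines "X \<equiv> orbit (sym_group n) relabel \<sigma>"
    and "Y \<equiv> orbit (sym_group (n + 1)) relabel (add_root n \<sigma>)"
  assumes \<sigma>: "partial_map_on {1..n} \<sigma>"
  shows "(\<Sum>y | y permutes {1..n+1}. card {\<tau> \<in> X. relabel g (relabel y (add_root n \<tau>)) =
           relabel y (add_root n \<tau>)}) = fact n * card {\<omega> \<in> Y. relabel g \<omega> = \<omega>}"
proof -
  let ?S = "{y. y permutes {1..n+1}}"
  let ?F = "\<lambda>(y, \<tau>). relabel y (add_root n \<tau>)"
  have X: "X = (\<lambda>p. relabel p \<sigma>) ` {p. p permutes {1..n}}"
    and Y: "Y = (\<lambda>p. relabel p (add_root n \<sigma>)) ` ?S"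
    by (simp_all add: X_def Y_def sym_group_orbit)
  have fin: "finite X" "finite Y" "finite ?S" by (simp_all add: X Y finite_permutations)
  \<comment> \<open>With \<tau> obtained from \<sigma> by \<open>q\<close>, the factor
    \<open>q\<close> is absorbed into \<open>y\<close>, which gives a relabelling of
    \<open>add_root n \<sigma>\<close> itself.\<close>
  have "?F ` (?S \<times> X) \<subseteq> Y"
  proof clarsimp
    fix y \<tau> assume y: "y permutes {Suc 0..Suc n}" and "\<tau> \<in> X"
    then obtain q where q: "q permutes {1..n}" "\<tau> = relabel q \<sigma>" by (auto simp: X)
    have "q permutes {1..n+1}" by (rule permutes_subset[OF q(1)]) auto
    then have "y \<circ> q permutes {1..n+1}" using y by (simp add: permutes_compose)
    moreover have "relabel y (add_root n \<tau>) = relabel (y \<circ> q) (add_root n \<sigma>)"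
      using y q by (simp add: relabel_comp permutes_bij relabel_add_root)
    ultimately show "relabel y (add_root n \<tau>) \<in> Y" by (auto simp: Y)
  qed
  note group = sum.group[OF finite_cartesian_product[OF fin(3,1)] fin(2) this]
  have fibre: "card {w \<in> ?S \<times> X. ?F w = \<omega>} = fact n" if \<omega>: "\<omega> \<in> Y" for \<omega>
  proof -
    obtain z where z: "z permutes {1..n+1}" "\<omega> = relabel z (add_root n \<sigma>)" using \<omega> by (auto simp: Y)
    show ?thesis
      unfolding card_orbit_pairs[OF \<sigma> z(1), symmetric] z(2) X_def
      by (rule arg_cong[of _ _ card]) auto
  qed
  have "(\<Sum>y\<in>?S. card {\<tau> \<in> X. relabel g (relabel y (add_root n \<tau>)) = relabel y (add_root n \<tau>)})
      = (\<Sum>y\<in>?S. \<Sum>\<tau>\<in>X. if relabel g (relabel y (add_root n \<tau>)) = relabel y (add_root n \<tau>)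
           then 1 else 0)"
    using fin by (simp add: sum.If_cases Int_def)
  also have "\<dots> = (\<Sum>w\<in>?S \<times> X. if relabel g (?F w) = ?F w then 1 else 0)"
    by (simp add: sum.cartesian_product case_prod_beta)
  also have "\<dots> = (\<Sum>\<omega>\<in>Y. \<Sum>w | w \<in> ?S \<times> X \<and> ?F w = \<omega>. if relabel g (?F w) = ?F w then 1 else 0)"
    by (rule group[symmetric])
  also have "\<dots> = (\<Sum>\<omega>\<in>Y. \<Sum>w | w \<in> ?S \<times> X \<and> ?F w = \<omega>. if relabel g \<omega> = \<omega> then 1 else 0)"
    by (intro sum.cong) auto
  also have "\<dots> = (\<Sum>\<omega>\<in>Y. if relabel g \<omega> = \<omega> then fact n else 0)"
    by (rule sum.cong[OF refl]) (use fibre in simp)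
  also have "\<dots> = fact n * card {\<omega> \<in> Y. relabel g \<omega> = \<omega>}"
    using fin by (simp add: sum.If_cases Int_def)
  finally show ?thesis .
qed

text \<open>The permutation \<open>g\<close> fixes the tree relabelled by \<open>y\<close> exactly
  when the conjugate \<open>inv' y \<circ> g \<circ> y\<close> fixes the tree before relabelling. If
  the conjugate lies in S_n, this means fixing \<tau>; otherwise it fixes no such tree and the sum
  on the left is empty.\<close>

lemma fixed_points_stabilizer:
  fixes n :: nat and \<sigma> :: "nat \<Rightarrow> nat option"
  defines "X \<equiv> orbit (sym_group n) relabel \<sigma>"
  assumes \<sigma>: "partial_map_on {1..n} \<sigma>"
    and g: "g permutes {1..n+1}" and y: "y permutes {1..n+1}"
  shows "(\<Sum>q | q permutes {1..n} \<and> q = inv' y \<circ> g \<circ> y. card {\<tau> \<in> X. relabel q \<tau> = \<tau>}) =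
    card {\<tau> \<in> X. relabel g (relabel y (add_root n \<tau>)) = relabel y (add_root n \<tau>)}"
proof -
  let ?q = "inv' y \<circ> g \<circ> y"
  have q1: "?q permutes {1..n+1}" using y g by (simp add: permutes_compose permutes_inv)
  have X: "X = (\<lambda>p. relabel p \<sigma>) ` {p. p permutes {1..n}}"
    by (simp add: X_def sym_group_orbit)
  have \<tau>: "partial_map_on {1..n} \<tau>" if "\<tau> \<in> X" for \<tau>
    using that \<sigma> by (auto simp: X partial_map_on_relabel)
  have "relabel y (relabel ?q f) = relabel g (relabel y f)" for f
    using y g by (simp add: relabel_comp permutes_bij bij_comp bij_imp_bij_inv relabel_inv_cancel)
  then have eq: "relabel g (relabel y f) = relabel y f \<longleftrightarrow> relabel ?q f = f" for f
    using relabel_eq_iff[OF permutes_bij[OF y]] by metis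
  show ?thesis
  proof (cases "?q permutes {1..n}")
    case True
    then have "{q. q permutes {1..n} \<and> q = ?q} = {?q}" by blast
    moreover have "relabel ?q (add_root n \<tau>) = add_root n \<tau> \<longleftrightarrow> relabel ?q \<tau> = \<tau>" if "\<tau> \<in> X" for \<tau>
      using add_root_eq_iff[OF partial_map_on_relabel[OF True \<tau>[OF that]] \<tau>[OF that]]
      by (simp only: relabel_add_root[OF True])
    ultimately show ?thesis unfolding eq by (simp cong: conj_cong)
  next
    case False
    then have "{q. q permutes {1..n} \<and> q = ?q} = {}" by blast
    moreover have "{\<tau> \<in> X. relabel ?q (add_root n \<tau>) = add_root n \<tau>} = {}"
      using False permutes_if_relabel_add_root[OF q1 \<tau> \<tau>] by blast
    ultimately show ?thesis unfolding eq by (simp only: sum.empty card.empty)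
  qed
qed

section \<open>The Young embedding of S_1 x S_n and its induced character\<close>

text \<open>The cycle taking \<open>{1..n}\<close> to \<open>{2..n+1}\<close>, the block on which
  \<open>young_embed 1\<close> lets S_n act, and \<open>n + 1\<close> to 1, the point of the S_1
  factor.\<close>

definition shift_cycle :: "nat \<Rightarrow> nat \<Rightarrow> nat" where
  "shift_cycle n i = (if i \<in> {1..n} then i + 1 else if i = n + 1 then 1 else i)"

lemma shift_cycle_permutes: "shift_cycle n permutes {1..n+1}"
proof (rule bij_imp_permutes)
  have "inj_on (shift_cycle n) {1..n+1}" "shift_cycle n ` {1..n+1} \<subseteq> {1..n+1}"
    by (auto simp: inj_on_def shift_cycle_def)
  then show "bij_betw (shift_cycle n) {1..n+1} {1..n+1}"
    by (simp add: bij_betw_def endo_inj_surj)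
qed (auto simp: shift_cycle_def)

text \<open>Both composites send \<open>i\<close> in \<open>{1..n}\<close> to
  \<open>q i + 1\<close>, send \<open>n + 1\<close> to 1 and fix everything else. Thus the embedded
  permutation is the conjugate of \<open>q\<close> by the cycle.\<close>

lemma young_embed_shift_cycle:
  assumes q: "q permutes {1..n}"
  shows "young_embed 1 (id, q) \<circ> shift_cycle n = shift_cycle n \<circ> q"
proof
  fix i
  have "q i \<in> {1..n} \<longleftrightarrow> i \<in> {1..n}" by (rule permutes_in_image[OF q])
  moreover have "q i = i" if "i \<notin> {1..n}" using that by (rule permutes_not_in[OF q])
  \<comment> \<open>Beyond \<open>n + 1\<close> the embedding still evaluates \<open>q\<close> at
    \<open>i - 1\<close>, which exceeds \<open>n\<close> and is therefore fixed.\<close>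
  moreover have "q (i - 1) = i - 1" if "n + 1 < i" using that by (intro permutes_not_in[OF q]) auto
  ultimately show "(young_embed 1 (id, q) \<circ> shift_cycle n) i = (shift_cycle n \<circ> q) i"
    by (auto simp: young_embed_def shift_cycle_def)
qed

text \<open>Cancelling the cycle on both sides moves it from the embedding into the conjugating
  element.\<close>

lemma young_embed_eq_conj_iff:
  assumes q: "q permutes {1..n}" and x: "x permutes {1..n+1}"
  shows "young_embed 1 (id, q) = inv' x \<circ> g \<circ> x \<longleftrightarrow>
    q = inv' (x \<circ> shift_cycle n) \<circ> g \<circ> (x \<circ> shift_cycle n)"
proof -
  let ?s = "shift_cycle n"
  have s: "bij ?s" by (rule permutes_bij[OF shift_cycle_permutes])
  have cancel: "?s \<circ> inv' ?s = id" "inv' ?s \<circ> ?s = id"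
    using permutes_inv_o[OF shift_cycle_permutes] by auto
  have "young_embed 1 (id, q) = inv' x \<circ> g \<circ> x \<longleftrightarrow>
      young_embed 1 (id, q) \<circ> ?s = inv' x \<circ> g \<circ> x \<circ> ?s"
  proof
    assume "young_embed 1 (id, q) \<circ> ?s = inv' x \<circ> g \<circ> x \<circ> ?s"
    then have "young_embed 1 (id, q) \<circ> ?s \<circ> inv' ?s = inv' x \<circ> g \<circ> x \<circ> ?s \<circ> inv' ?s"
      by (rule arg_cong)
    then show "young_embed 1 (id, q) = inv' x \<circ> g \<circ> x" by (simp only: comp_assoc cancel comp_id)
  qed simp
  also have "\<dots> \<longleftrightarrow> ?s \<circ> q = inv' x \<circ> g \<circ> x \<circ> ?s" by (simp only: young_embed_shift_cycle[OF q])
  also have "\<dots> \<longleftrightarrow> q = inv' ?s \<circ> (inv' x \<circ> g \<circ> x \<circ> ?s)"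
  proof
    assume "?s \<circ> q = inv' x \<circ> g \<circ> x \<circ> ?s"
    then have "inv' ?s \<circ> (?s \<circ> q) = inv' ?s \<circ> (inv' x \<circ> g \<circ> x \<circ> ?s)" by (rule arg_cong)
    then show "q = inv' ?s \<circ> (inv' x \<circ> g \<circ> x \<circ> ?s)" by (simp only: comp_assoc[symmetric] cancel id_comp)
  next
    assume "q = inv' ?s \<circ> (inv' x \<circ> g \<circ> x \<circ> ?s)"
    then show "?s \<circ> q = inv' x \<circ> g \<circ> x \<circ> ?s" by (simp only: comp_assoc[symmetric] cancel id_comp)
  qed
  also have "inv' ?s \<circ> (inv' x \<circ> g \<circ> x \<circ> ?s) = inv' (x \<circ> ?s) \<circ> g \<circ> (x \<circ> ?s)"
    using s permutes_bij[OF x] by (simp add: o_inv_distrib comp_assoc)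
  finally show ?thesis .
qed

text \<open>The S_1 factor contributes only the value 1, and the cycle disappears by reindexing.
  What remains is induction from the stabilizer of \<open>n + 1\<close>, with S_n included in the
  plain way.\<close>

lemma ind_prod_1_eq:
  assumes \<chi>: "\<chi> id = 1" and g: "g permutes {1..n+1}"
  shows "ind_prod 1 n \<chi> \<psi> g =
    (\<Sum>y | y permutes {1..n+1}. \<Sum>q | q permutes {1..n} \<and> q = inv' y \<circ> g \<circ> y. \<psi> q) / fact n"
proof -
  let ?S = "{y. y permutes {1..n+1}}"
  let ?H = "sym_group 1 \<times>\<times> sym_group n"
  let ?s = "shift_cycle n"
  have H: "carrier ?H = {id} \<times> {q. q permutes {1..n}}"
    by (auto simp: sym_group_carrier)
  have "order ?H = fact n"
    unfolding order_def H by (simp add: card_cartesian_product card_permutations)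
  then have "ind_prod 1 n \<chi> \<psi> g = (\<Sum>x\<in>?S. \<Sum>h | h \<in> carrier ?H \<and>
      young_embed 1 h = inv\<^bsub>sym_group (1 + n)\<^esub> x \<otimes>\<^bsub>sym_group (1 + n)\<^esub> g \<otimes>\<^bsub>sym_group (1 + n)\<^esub> x.
      tensor_char \<chi> \<psi> h) / fact n"
    unfolding ind_prod_def ind_char_def by (simp add: sym_group_def)
  also have "(\<Sum>x\<in>?S. \<Sum>h | h \<in> carrier ?H \<and>
      young_embed 1 h = inv\<^bsub>sym_group (1 + n)\<^esub> x \<otimes>\<^bsub>sym_group (1 + n)\<^esub> g \<otimes>\<^bsub>sym_group (1 + n)\<^esub> x.
      tensor_char \<chi> \<psi> h)
    = (\<Sum>x\<in>?S. \<Sum>q | q permutes {1..n} \<and> q = inv' (x \<circ> ?s) \<circ> g \<circ> (x \<circ> ?s). \<psi> q)"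
  proof (rule sum.cong[OF refl])
    fix x assume "x \<in> ?S"
    then have x: "x permutes {1..n+1}" by simp
    have conj: "inv\<^bsub>sym_group (1 + n)\<^esub> x \<otimes>\<^bsub>sym_group (1 + n)\<^esub> g \<otimes>\<^bsub>sym_group (1 + n)\<^esub> x = inv' x \<circ> g \<circ> x"
      using sym_group_inv[of x "1 + n"] x by (simp add: sym_group_mult)
    show "(\<Sum>h | h \<in> carrier ?H \<and>
        young_embed 1 h = inv\<^bsub>sym_group (1 + n)\<^esub> x \<otimes>\<^bsub>sym_group (1 + n)\<^esub> g \<otimes>\<^bsub>sym_group (1 + n)\<^esub> x.
        tensor_char \<chi> \<psi> h)
      = (\<Sum>q | q permutes {1..n} \<and> q = inv' (x \<circ> ?s) \<circ> g \<circ> (x \<circ> ?s). \<psi> q)"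
      unfolding conj H
      by (rule sum.reindex_bij_witness[where i = "\<lambda>q. (id, q)" and j = snd])
        (use young_embed_eq_conj_iff[OF _ x, of _ g] in \<open>auto simp: tensor_char_def \<chi>\<close>)
  qed
  also have "\<dots> = (\<Sum>y\<in>?S. \<Sum>q | q permutes {1..n} \<and> q = inv' y \<circ> g \<circ> y. \<psi> q)"
    by (rule sum.reindex_bij_witness[where i = "\<lambda>y. y \<circ> inv' ?s" and j = "\<lambda>x. x \<circ> ?s"])
      (use shift_cycle_permutes[of n] in
        \<open>simp_all add: comp_assoc permutes_inv_o permutes_compose permutes_inv\<close>)
  finally show ?thesis .
qed

theorem theorem5p4:
  fixes n :: nat
    and \<sigma> :: "nat \<Rightarrow> nat option"
    and I :: "(nat \<Rightarrow> nat, 'b) matrix_rep"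
  assumes "rooted_forest n \<sigma>"
    and "irreducible_rep (sym_group 1) I"
  shows "\<forall>g \<in> carrier (sym_group (n + 1)).
           rep_char (odun (n + 1) (add_root n \<sigma>)) g
             = ind_prod 1 n (rep_char I) (rep_char (odun n \<sigma>)) g"
proof
  fix g assume "g \<in> carrier (sym_group (n + 1))"
  then have g: "g permutes {1..n+1}" by (simp add: sym_group_carrier)
  have \<sigma>: "partial_map_on {1..n} \<sigma>"
    using assms(1) by (simp add: rooted_forest_def partial_map_on_def)
  have "carrier (sym_group 1) = {\<one>\<^bsub>sym_group 1\<^esub>}"
    by (auto simp: sym_group_carrier sym_group_one)
  from irreducible_rep_trivial_group_char[OF this assms(2)]
  have I: "rep_char I id = 1" by (simp add: sym_group_one)
  let ?X = "orbit (sym_group n) relabel \<sigma>"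
  have "ind_prod 1 n (rep_char I) (rep_char (odun n \<sigma>)) g =
    complex_of_nat (\<Sum>y | y permutes {1..n+1}. \<Sum>q | q permutes {1..n} \<and> q = inv' y \<circ> g \<circ> y.
      card {\<tau> \<in> ?X. relabel q \<tau> = \<tau>}) / fact n"
    unfolding ind_prod_1_eq[of "rep_char I", OF I g] rep_char_odun by simp
  also have "(\<Sum>y | y permutes {1..n+1}. \<Sum>q | q permutes {1..n} \<and> q = inv' y \<circ> g \<circ> y.
      card {\<tau> \<in> ?X. relabel q \<tau> = \<tau>}) =
    (\<Sum>y | y permutes {1..n+1}.
      card {\<tau> \<in> ?X. relabel g (relabel y (add_root n \<tau>)) = relabel y (add_root n \<tau>)})"
    using fixed_points_stabilizer[OF \<sigma> g] by (intro sum.cong) auto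
  also have "\<dots> = fact n *
      card {\<omega> \<in> orbit (sym_group (n + 1)) relabel (add_root n \<sigma>). relabel g \<omega> = \<omega>}"
    by (rule fixed_points_add_root[OF \<sigma>])
  finally show "rep_char (odun (n + 1) (add_root n \<sigma>)) g
      = ind_prod 1 n (rep_char I) (rep_char (odun n \<sigma>)) g"
    unfolding rep_char_odun[of "n + 1"] by simp
qed

end
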